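(* Let an $\mathrm{AVI}(C,q,M)$ be given, with $C\subset\mathbb{R}^n$ a polyhedral convex set, $M\in\mathbb{R}^{n\times n}$, $q\in\mathbb{R}^n$, and let $z\in C$ be an implicit extreme point of $C$. Assume that $M$ is invertible on the lineality space of $C$. Then there exists $\hat z\in z+\operatorname{lin}C$ such that $M\hat z+q\in\operatorname{aff}(N_C(\hat z))$.
   Context: $\mathrm{AVI}(C,q,M)$: find $z\in C$ with $\langle Mz+q,y-z\rangle\ge0$ for all $y\in C$. $\operatorname{lin}C$ is the lineality space; $N_C(z)=\{y:\langle y,z'-z\rangle\le0\ \forall z'\in C\}$; $\operatorname{aff}$ is the affine hull. A point $z\in C$ is an implicit extreme point of $C$ if $z=\lambda z^1+(1-\lambda)z^2$ with $z^1,z^2\in C$, $\lambda\in(0,1)$ implies $z-z^1,z-z^2\in\operatorname{lin}C$. "$M$ is invertible on the lineality space of $C$" means $Q^TMQ$ is invertible, where the columns of $Q$ are an orthonormal basis of $\operatorname{lin}C$ (vacuous if $\operatorname{lin}C=\{0\}$). *)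

theory Defs
  imports "HOL-Analysis.Analysis" "Jordan_Normal_Form.Matrix"
begin

no_notation scalar_prod (infix "\<bullet>" 70)

definition recession_cone :: "'a::real_vector set \<Rightarrow> 'a set" where
  "recession_cone C = {d. \<forall>x\<in>C. \<forall>t\<ge>0. x + t *\<^sub>R d \<in> C}"

definition lineality_space :: "'a::real_vector set \<Rightarrow> 'a set" where
  "lineality_space C = {d. d \<in> recession_cone C \<and> - d \<in> recession_cone C}"

definition normal_cone :: "'a::real_inner set \<Rightarrow> 'a \<Rightarrow> 'a set" where
  "normal_cone C z = {y. \<forall>z'\<in>C. y \<bullet> (z' - z) \<le> 0}"

definition implicit_extreme_point :: "'a::real_vector \<Rightarrow> 'a set \<Rightarrow> bool" where
  "implicit_extreme_point z C \<longleftrightarrow> z \<in> C \<and>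
    (\<forall>z1\<in>C. \<forall>z2\<in>C. \<forall>l. 0 < l \<and> l < 1 \<and> z = l *\<^sub>R z1 + (1 - l) *\<^sub>R z2 \<longrightarrow>
       z - z1 \<in> lineality_space C \<and> z - z2 \<in> lineality_space C)"

definition is_orthonormal_basis :: "'a::real_inner list \<Rightarrow> 'a set \<Rightarrow> bool" where
  "is_orthonormal_basis qs L \<longleftrightarrow>
    (\<forall>i<length qs. \<forall>j<length qs. qs ! i \<bullet> qs ! j = (if i = j then 1 else 0)) \<and>
    span (set qs) = L"

text \<open>For the matrix \<open>Q\<close> whose columns are the vectors in \<open>qs\<close>, this is \<open>Q\<^sup>T M Q\<close>, given by
  its entries. The number of columns is not fixed by a type, hence the matrix type with
  explicit dimensions; it may be zero.\<close>

definition compression :: "(real^'n) list \<Rightarrow> real^'n^'n \<Rightarrow> real mat" where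
  "compression qs M =
     Matrix.mat (length qs) (length qs) (\<lambda>(i, j). qs ! i \<bullet> (M *v (qs ! j)))"

text \<open>Two orthonormal bases of the same subspace give orthogonally similar matrices \<open>Q\<^sup>T M Q\<close>, so
  it does not matter which basis is taken. For the zero subspace, \<open>qs\<close> is empty
  and the \<open>0 \<times> 0\<close> matrix is invertible, so the condition holds vacuously.\<close>

definition invertible_on_lineality_space :: "real^'n^'n \<Rightarrow> (real^'n) set \<Rightarrow> bool" where
  "invertible_on_lineality_space M C \<longleftrightarrow>
    (\<exists>qs. is_orthonormal_basis qs (lineality_space C) \<and> invertible_mat (compression qs M))"

end

(* For z an implicit extreme point of C, a direction orthogonal to N_C(z) is orthogonal to the
   normals of all constraints active at z, so z can be moved a little both ways along it inside C;
   hence it lies in L = lin C. Therefore the orthogonal complement of L is contained in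
   span N_C(z) = aff N_C(z), and N_C(z) does not change when z moves along L. It remains to move
   z along L so that M z + q becomes orthogonal to L: a linear system with matrix Q^T M Q. *)

theory Submission
  imports Defs
begin

text \<open>Each of the finitely many half-spaces tolerates small \<open>t\<close> of either sign.
  If its constraint is active at \<open>z\<close>, its normal \<open>a\<close> lies in the normal
  cone, so \<open>a\<close> is orthogonal to \<open>w\<close> and the value stays \<open>b\<close>;
  if it is strict, continuity keeps it strict.\<close>

lemma eventually_move_in_polyhedron:
  fixes C :: "'a::euclidean_space set"
  assumes "polyhedron C" "z \<in> C" and orth: "\<And>y. y \<in> normal_cone C z \<Longrightarrow> y \<bullet> w = 0"
  shows "eventually (\<lambda>t. z + t *\<^sub>R w \<in> C) (nhds 0)"
proof -
  obtain F where F: "finite F" "C = \<Inter>F"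
      "\<And>h. h \<in> F \<Longrightarrow> \<exists>a b. a \<noteq> 0 \<and> h = {x. a \<bullet> x \<le> b}"
    using assms(1) unfolding polyhedron_def by blast
  have "eventually (\<lambda>t. z + t *\<^sub>R w \<in> h) (nhds 0)" if "h \<in> F" for h
  proof -
    obtain a b where h: "h = {x. a \<bullet> x \<le> b}" using F(3) \<open>h \<in> F\<close> by blast
    have "a \<bullet> z \<le> b" using assms(2) F(2) that h by auto
    then consider "a \<bullet> z = b" | "a \<bullet> z < b" by linarith
    then show ?thesis
    proof cases
      case 1
      have "C \<subseteq> {x. a \<bullet> x \<le> b}" using F(2) that h by blast
      then have "a \<in> normal_cone C z"
        using 1 by (auto simp: normal_cone_def inner_diff_right)
      then show ?thesis using 1 orth h by (simp add: inner_add_right)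
    next
      case 2
      have "((\<lambda>t. a \<bullet> (z + t *\<^sub>R w)) \<longlongrightarrow> a \<bullet> (z + 0 *\<^sub>R w)) (nhds 0)"
        by (intro tendsto_intros filterlim_ident)
      then have "eventually (\<lambda>t. a \<bullet> (z + t *\<^sub>R w) < b) (nhds 0)"
        using 2 by (intro order_tendstoD(2)) auto
      then show ?thesis by (rule eventually_mono) (simp add: h)
    qed
  qed
  then have "eventually (\<lambda>t. \<forall>h\<in>F. z + t *\<^sub>R w \<in> h) (nhds 0)"
    using F(1) by (intro eventually_ball_finite) auto
  then show ?thesis using F(2) by simp
qed

lemma orthogonal_normal_cone_imp_lineality:
  fixes C :: "'a::euclidean_space set"
  assumes "polyhedron C" "implicit_extreme_point z C" "subspace (lineality_space C)"
    and orth: "\<And>y. y \<in> normal_cone C z \<Longrightarrow> y \<bullet> w = 0"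
  shows "w \<in> lineality_space C"
proof -
  have "z \<in> C" using assms(2) by (simp add: implicit_extreme_point_def)
  then obtain e where e: "e > 0" "\<And>t. dist t 0 < e \<Longrightarrow> z + t *\<^sub>R w \<in> C"
    using eventually_move_in_polyhedron[OF assms(1) _ orth] by (auto simp: eventually_nhds_metric)
  \<comment> \<open>Halving puts both \<open>t\<close> and \<open>- t\<close> strictly inside the
    radius \<open>e\<close>.\<close>
  define t where "t = e / 2"
  have t: "t > 0" "z + t *\<^sub>R w \<in> C" "z + (- t) *\<^sub>R w \<in> C"
    using e(1) e(2)[of t] e(2)[of "- t"] by (auto simp: t_def dist_real_def)
  \<comment> \<open>As the midpoint of two points of \<open>C\<close>, \<open>z\<close> differs from
    each by a lineality direction; the difference is a nonzero multiple of \<open>w\<close>.\<close>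
  have "z = (1/2) *\<^sub>R (z + t *\<^sub>R w) + (1 - 1/2) *\<^sub>R (z + (- t) *\<^sub>R w)"
    by (simp add: scaleR_add_right scaleR_diff_right flip: scaleR_add_left)
  moreover have "(0::real) < 1/2" "(1/2::real) < 1" by auto
  ultimately have "z - (z + (- t) *\<^sub>R w) \<in> lineality_space C"
    using assms(2) t unfolding implicit_extreme_point_def by blast
  then have "t *\<^sub>R w \<in> lineality_space C" by simp
  then have "(1 / t) *\<^sub>R t *\<^sub>R w \<in> lineality_space C" using assms(3) by (rule subspace_scale[rotated])
  then show ?thesis using t by simp
qed

text \<open>Since \<open>- l\<close> is a recession direction, testing \<open>y\<close> at
  \<open>x\<close> relative to \<open>z + l\<close> amounts to testing it at the point
  \<open>x - l\<close> of \<open>C\<close> relative to \<open>z\<close>.\<close>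

lemma normal_cone_lineality_translate:
  assumes "l \<in> lineality_space C"
  shows "normal_cone C z \<subseteq> normal_cone C (z + l)"
proof
  fix y assume y: "y \<in> normal_cone C z"
  show "y \<in> normal_cone C (z + l)"
    unfolding normal_cone_def
  proof clarify
    fix x assume "x \<in> C"
    then have "x + 1 *\<^sub>R (- l) \<in> C"
      using assms unfolding lineality_space_def recession_cone_def
      by (simp del: scaleR_one)
    then have "y \<bullet> (x + 1 *\<^sub>R (- l) - z) \<le> 0" using y unfolding normal_cone_def by blast
    then show "y \<bullet> (x - (z + l)) \<le> 0" by (simp add: algebra_simps)
  qed
qed

text \<open>The component \<open>w\<close> of \<open>v\<close> orthogonal to the span of the normal
  cone is a lineality direction, hence orthogonal to \<open>v\<close> as well as to
  \<open>y\<close>, so it vanishes. Span and affine hull agree because the cone contains 0.\<close>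

lemma orthogonal_lineality_imp_affine_hull_normal_cone:
  fixes C :: "'a::euclidean_space set"
  assumes "polyhedron C" "implicit_extreme_point z C" "subspace (lineality_space C)"
    and "\<And>l. l \<in> lineality_space C \<Longrightarrow> l \<bullet> v = 0"
  shows "v \<in> affine hull (normal_cone C z)"
proof -
  let ?S = "span (normal_cone C z)"
  obtain y w where yw: "y \<in> ?S" "\<And>u. u \<in> ?S \<Longrightarrow> Linear_Algebra.orthogonal w u" "v = y + w"
    using orthogonal_subspace_decomp_exists[of "normal_cone C z" v] by blast
  have "w \<in> lineality_space C"
    by (rule orthogonal_normal_cone_imp_lineality[OF assms(1-3)])
      (use yw(2)[OF span_base] in \<open>simp add: Linear_Algebra.orthogonal_def inner_commute\<close>)
  then have "w \<bullet> v = 0" by (rule assms(4))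
  moreover have "w \<bullet> y = 0" using yw by (simp add: Linear_Algebra.orthogonal_def)
  ultimately have "w = 0" using yw(3) by (simp add: inner_add_right)
  then have "v \<in> ?S" using yw by simp
  moreover have "0 \<in> normal_cone C z" by (simp add: normal_cone_def)
  ultimately show ?thesis by (simp add: affine_hull_span_0 hull_inc)
qed

text \<open>With \<open>l = Q x\<close>, testing against the columns of \<open>Q\<close> gives the
  square system \<open>Q^T M Q x = - Q^T p\<close>.\<close>

lemma invertible_compression_solves:
  fixes M :: "real^'n^'n"
  assumes "invertible_mat (compression qs M)"
  shows "\<exists>l\<in>span (set qs). \<forall>u\<in>span (set qs). u \<bullet> (M *v l + p) = 0"
proof -
  define n where "n = length qs"
  define A where "A = compression qs M"
  have A: "A \<in> carrier_mat n n" by (simp add: A_def n_def compression_def)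
  obtain B where AB: "A * B = 1\<^sub>m n" "B * A = 1\<^sub>m (dim_row B)"
    using assms A unfolding invertible_mat_def inverts_mat_def A_def[symmetric] by auto
  \<comment> \<open>\<open>invertible_mat\<close> leaves the shape of the inverse open; it is read
    off from the two identity matrices.\<close>
  have "dim_col B = n" using arg_cong[OF AB(1), of dim_col] by simp
  moreover have "dim_row B = n" using arg_cong[OF AB(2), of dim_col] A by simp
  ultimately have B: "B \<in> carrier_mat n n" by auto
  define r where "r = Matrix.vec n (\<lambda>i. - (qs ! i \<bullet> p))"
  define x where "x = B *\<^sub>v r"
  have x: "x \<in> carrier_vec n" using B by (simp add: x_def r_def)
  have "A *\<^sub>v x = (A * B) *\<^sub>v r"
    unfolding x_def using A B by (simp add: assoc_mult_mat_vec[of A n n B n] r_def)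
  then have Ax: "A *\<^sub>v x = r" using AB(1) by (simp add: r_def)
  define l where "l = (\<Sum>j<n. vec_index x j *\<^sub>R qs ! j)"
  have "l \<in> span (set qs)"
    unfolding l_def by (intro span_sum span_scale span_base) (simp add: n_def)
  moreover have basis: "qs ! i \<bullet> (M *v l + p) = 0" if "i < n" for i
  proof -
    have "qs ! i \<bullet> (M *v l) = (\<Sum>j<n. (qs ! i \<bullet> (M *v (qs ! j))) * vec_index x j)"
      unfolding l_def
      by (simp add: linear_sum[OF matrix_vector_mul_linear] inner_sum_right
          matrix_vector_mult_scaleR mult.commute)
    also have "\<dots> = vec_index (A *\<^sub>v x) i"
      using that A x
      by (simp add: A_def compression_def n_def scalar_prod_def atLeast0LessThan)
    also have "\<dots> = - (qs ! i \<bullet> p)" using that by (simp add: Ax r_def)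
    finally show ?thesis by (simp add: inner_add_right)
  qed
  have "u \<bullet> (M *v l + p) = 0" if "u \<in> span (set qs)" for u
  proof -
    have "Linear_Algebra.orthogonal (M *v l + p) u"
      by (rule orthogonal_to_span[OF that])
        (use basis in \<open>auto simp: in_set_conv_nth n_def Linear_Algebra.orthogonal_def inner_commute\<close>)
    then show ?thesis by (simp add: Linear_Algebra.orthogonal_def inner_commute)
  qed
  ultimately show ?thesis by blast
qed

theorem proposition3p5:
  fixes C :: "(real^'n) set" and M :: "real^'n^'n" and q z :: "real^'n"
  assumes "polyhedron C"
    and "z \<in> C"
    and "implicit_extreme_point z C"
    and "invertible_on_lineality_space M C"
  shows "\<exists>zh \<in> (+) z ` lineality_space C. M *v zh + q \<in> affine hull (normal_cone C zh)"
proof -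
  obtain qs where qs: "span (set qs) = lineality_space C" "invertible_mat (compression qs M)"
    using assms(4) unfolding invertible_on_lineality_space_def is_orthonormal_basis_def by blast
  \<comment> \<open>The choice \<open>p = M z + q\<close> makes \<open>M l + p\<close> the value of
    the affine map at \<open>z + l\<close>.\<close>
  obtain l where l: "l \<in> lineality_space C"
      "\<forall>u\<in>lineality_space C. u \<bullet> (M *v l + (M *v z + q)) = 0"
    using invertible_compression_solves[OF qs(2), of "M *v z + q"] unfolding qs(1) by (elim bexE)
  \<comment> \<open>The lineality space is a subspace because it is the span of
    \<open>qs\<close>.\<close>
  have "subspace (lineality_space C)" by (simp flip: qs(1))
  then have "M *v l + (M *v z + q) \<in> affine hull (normal_cone C z)"
    using orthogonal_lineality_imp_affine_hull_normal_cone[OF assms(1,3)] l(2) by blast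
  moreover have "M *v l + (M *v z + q) = M *v (z + l) + q"
    by (simp add: matrix_vector_right_distrib)
  ultimately have "M *v (z + l) + q \<in> affine hull (normal_cone C (z + l))"
    using hull_mono[OF normal_cone_lineality_translate[OF l(1)]] by auto
  then show ?thesis using l(1) by blast
qed

end
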